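(* Let $p$ be a non-negative integer and let $G$ be a connected $\{\text{butterfly},\text{hammer},(K_1\cup K_2)+K_p\}$-free graph with $\omega(G)\geq 2p$. If $\omega(G)\neq 2$, then $G$ is perfect.
   Context: All graphs are simple, finite and undirected. $\omega(G)$ is the clique number and $\chi(G)$ the chromatic number of $G$. A graph $G$ is perfect if $\chi(H)=\omega(H)$ for every induced subgraph $H$ of $G$. For a family $\mathcal{F}$ of graphs, $G$ is $\mathcal{F}$-free if it has no induced subgraph isomorphic to a member of $\mathcal{F}$. The butterfly is the graph on five vertices consisting of two triangles sharing exactly one vertex (with no other edges). The hammer is the graph on five vertices $a,b,c,d,e$ with edges $ab,bc,ac,cd,de$. $K_n$ is the complete graph on $n$ vertices, $K_1\cup K_2$ is the disjoint union of $K_1$ and $K_2$, and for vertex-disjoint graphs $G_1,G_2$ the join $G_1+G_2$ is obtained from their disjoint union by adding all edges between $V(G_1)$ and $V(G_2)$; for $p=0$, $(K_1\cup K_2)+K_p$ is $K_1\cup K_2$. *)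

theory Defs
  imports "Graph_Theory.Digraph_Isomorphism" "Graph_Theory.Kuratowski"
begin

text \<open>
  Finite simple undirected graphs are the symmetric digraphs of the locale
  \<^locale>\<open>graph\<close>: an undirected edge is a pair of opposite arcs, and \<^const>\<open>arcs_ends\<close>
  is the adjacency relation.
\<close>

definition clique :: "('a, 'b) pre_digraph \<Rightarrow> 'a set \<Rightarrow> bool" where
  "clique G S \<longleftrightarrow> S \<subseteq> verts G \<and> (\<forall>u\<in>S. \<forall>v\<in>S. u \<noteq> v \<longrightarrow> (u, v) \<in> arcs_ends G)"

definition clique_number :: "('a, 'b) pre_digraph \<Rightarrow> nat" where
  "clique_number G = Max {card S | S. clique G S}"

definition proper_coloring :: "('a, 'b) pre_digraph \<Rightarrow> nat \<Rightarrow> ('a \<Rightarrow> nat) \<Rightarrow> bool" where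
  "proper_coloring G k c \<longleftrightarrow>
     (\<forall>v\<in>verts G. c v < k) \<and> (\<forall>(u, v)\<in>arcs_ends G. c u \<noteq> c v)"

definition chromatic_number :: "('a, 'b) pre_digraph \<Rightarrow> nat" where
  "chromatic_number G = (LEAST k. \<exists>c. proper_coloring G k c)"

definition perfect_graph :: "('a, 'b) pre_digraph \<Rightarrow> bool" where
  "perfect_graph G \<longleftrightarrow>
     (\<forall>H. induced_subgraph H G \<longrightarrow> chromatic_number H = clique_number H)"

definition free_of :: "('c, 'd) pre_digraph set \<Rightarrow> ('a, 'b) pre_digraph \<Rightarrow> bool" where
  "free_of \<F> G \<longleftrightarrow> \<not> (\<exists>F\<in>\<F>. \<exists>H. induced_subgraph H G \<and> digraph_iso H F)"

definition edge_graph :: "'a set \<Rightarrow> ('a \<times> 'a) set \<Rightarrow> ('a, 'a \<times> 'a) pre_digraph" where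
  "edge_graph V E = with_proj \<lparr> pverts = V, parcs = E \<union> E\<inverse> \<rparr>"

definition butterfly :: "(nat, nat \<times> nat) pre_digraph" where
  "butterfly = edge_graph {0,1,2,3,4} {(0,1), (0,2), (1,2), (0,3), (0,4), (3,4)}"

definition hammer :: "(nat, nat \<times> nat) pre_digraph" where
  "hammer = edge_graph {0,1,2,3,4} {(0,1), (1,2), (0,2), (2,3), (3,4)}"

definition complete_on :: "'a set \<Rightarrow> ('a, 'a \<times> 'a) pre_digraph" where
  "complete_on S = edge_graph S {(u, v). u \<in> S \<and> v \<in> S \<and> u \<noteq> v}"

text \<open>The library's \<^const>\<open>union\<close> and the join below do not rename vertices, so
  their arguments have to be vertex-disjoint.\<close>

definition join :: "('a, 'a \<times> 'a) pre_digraph \<Rightarrow> ('a, 'a \<times> 'a) pre_digraph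
    \<Rightarrow> ('a, 'a \<times> 'a) pre_digraph" where
  "join G H = union (union G H) (edge_graph (verts G \<union> verts H) (verts G \<times> verts H))"

definition K1_K2_join_K :: "nat \<Rightarrow> (nat, nat \<times> nat) pre_digraph" where
  "K1_K2_join_K p = join (union (complete_on {0}) (complete_on {1,2})) (complete_on {3..<3+p})"

lemma graph_edge_graph:
  assumes "finite V" "E \<subseteq> V \<times> V" "\<And>v. (v, v) \<notin> E"
  shows "Digraph.graph (edge_graph V E)"
proof -
  have "finite E"
    using assms finite_subset by blast
  with assms show ?thesis
    by unfold_locales
       (auto simp: edge_graph_def symmetric_def sym_def arcs_ends_conv arc_to_ends_def)
qed

lemma graph_butterfly: "Digraph.graph butterfly"
  unfolding butterfly_def by (rule graph_edge_graph) auto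

lemma graph_hammer: "Digraph.graph hammer"
  unfolding hammer_def by (rule graph_edge_graph) auto

lemma complete_on_is_complete:
  assumes "finite S"
  shows "K\<^bsub>card S\<^esub> (complete_on S)"
proof -
  have "Digraph.graph (complete_on S)"
    unfolding complete_on_def using assms by (intro graph_edge_graph) auto
  then show ?thesis
    by (auto simp: complete_digraph_def complete_on_def edge_graph_def)
qed

lemma K1_K2_join_K_eq:
  "K1_K2_join_K p = edge_graph {0..<3+p}
     ({(1,2)} \<union> {(u, v). u < v \<and> 3 \<le> v \<and> v < 3+p})"
proof (rule pre_digraph.equality)
  show "verts (K1_K2_join_K p) = verts (edge_graph {0..<3+p}
      ({(1,2)} \<union> {(u, v). u < v \<and> 3 \<le> v \<and> v < 3+p}))"
    unfolding K1_K2_join_K_def join_def union_def complete_on_def edge_graph_def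
    by (simp, unfold set_eq_iff, simp, presburger)
  show "arcs (K1_K2_join_K p) = arcs (edge_graph {0..<3+p}
      ({(1,2)} \<union> {(u, v). u < v \<and> 3 \<le> v \<and> v < 3+p}))"
    unfolding K1_K2_join_K_def join_def union_def complete_on_def edge_graph_def
    by (simp, unfold set_eq_iff split_paired_all, simp, presburger)
qed (simp_all add: K1_K2_join_K_def join_def union_def complete_on_def edge_graph_def)

lemma graph_K1_K2_join_K: "Digraph.graph (K1_K2_join_K p)"
  unfolding K1_K2_join_K_eq by (rule graph_edge_graph) auto

end

theory Submission
  imports Defs
begin

text \<open>
  Let $K$ be a maximum clique. If $\omega(G) \le 1$, then $G$ has no edges. Otherwise
  $\omega(G) \ge \max(3, 2p) \ge p + 2$, and freeness of $(K_1 \cup K_2) + K_p$ says that a vertex has either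
  fewer than $p$ or at least $\omega(G) - 1$ neighbours in every maximum clique. The vertices
  missing exactly one vertex of $K$ induce a complete multipartite graph $M$ with $\omega(G)$
  parts. Replacing the vertices of $K$ one at a time by other vertices of their parts changes the
  number of neighbours of a fixed vertex outside $M$ by at most one in each step, so that number
  can never leave the range below $p$; hence such a vertex meets fewer than $p$ parts. Two
  adjacent vertices outside $M$ therefore leave two parts untouched, and a neighbour of one of
  them in $M$ yields a butterfly or a hammer; by connectivity, the vertices outside $M$ are
  independent. A complete multipartite graph together with an independent set is perfect.
\<close>

section \<open>Forbidden induced subgraphs as adjacency patterns\<close>

text \<open>Reduces a violation of freeness to an embedding \<open>f\<close> that preserves and
  reflects adjacency: the subgraph induced on its image is isomorphic to the pattern via the inverse
  of \<open>f\<close>.\<close>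

lemma edge_graph_not_free:
  fixes G :: "('a, 'b) pre_digraph"
  assumes G: "Digraph.graph G" and free: "free_of \<F> G" and F: "edge_graph V E \<in> \<F>"
    and E: "E \<subseteq> V \<times> V" and inj: "inj_on f V" and sub: "f ` V \<subseteq> verts G"
    and adj: "\<And>u v. u \<in> V \<Longrightarrow> v \<in> V \<Longrightarrow> f u \<rightarrow>\<^bsub>G\<^esub> f v \<longleftrightarrow> (u, v) \<in> E \<union> E\<inverse>"
  shows False
proof -
  interpret G: Digraph.graph G by fact
  define H where "H = G \<restriction> (f ` V)"
  have H: "induced_subgraph H G"
    unfolding H_def using sub by (rule G.induced_induce)
  have vertsH: "verts H = f ` V" and arcsH: "arcs H = {e \<in> arcs G. tail G e \<in> f ` V \<and> head G e \<in> f ` V}"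
    and ends: "tail H = tail G" "head H = head G"
    by (simp_all add: H_def induce_subgraph_def)
  define g where "g = the_inv_into V f"
  have gf: "g (f v) = v" if "v \<in> V" for v
    using that inj by (simp add: g_def the_inv_into_f_f)
  have gV: "g x \<in> V" "f (g x) = x" if "x \<in> f ` V" for x
    using that gf by auto
  \<comment> \<open>The arcs of an \<open>edge_graph\<close> are the pairs of their ends, so an arc
    goes to the pair of its pulled-back ends. Injectivity on arcs is then the absence of parallel
    arcs in \<open>G\<close>.\<close>
  define h where "h = \<lparr> iso_verts = g, iso_arcs = (\<lambda>e. (g (tail G e), g (head G e))),
     iso_head = snd, iso_tail = fst \<rparr>"
  have injarcs: "inj_on (iso_arcs h) (arcs H)"
  proof (rule inj_onI)
    fix e e' assume e: "e \<in> arcs H" "e' \<in> arcs H" "iso_arcs h e = iso_arcs h e'"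
    then have "tail G e = f (g (tail G e'))" "head G e = f (g (head G e'))"
      using gV(2)[of "tail G e"] gV(2)[of "head G e"] by (auto simp: arcsH h_def)
    with e have "tail G e = tail G e'" "head G e = head G e'"
      using gV(2)[of "tail G e'"] gV(2)[of "head G e'"] by (auto simp: arcsH)
    with e show "e = e'"
      by (auto simp: arcsH arc_to_ends_def intro: G.no_multi_arcs)
  qed
  have "wf_digraph H"
    using H by auto
  moreover have "inj_on g (f ` V)"
    using gV(2) by (rule inj_on_inverseI)
  ultimately have "pre_digraph.digraph_isomorphism H h"
    using injarcs by (auto simp: pre_digraph.digraph_isomorphism_def vertsH ends h_def)
  moreover have "edge_graph V E = app_iso h H"
  proof (rule pre_digraph.equality)
    show "verts (edge_graph V E) = verts (app_iso h H)"
      using gf by (force simp: edge_graph_def h_def vertsH)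
    show "arcs (edge_graph V E) = arcs (app_iso h H)"
    proof (rule set_eqI, clarify)
      fix u v
      have "(u, v) \<in> iso_arcs h ` arcs H \<longleftrightarrow> u \<in> V \<and> v \<in> V \<and> f u \<rightarrow>\<^bsub>G\<^esub> f v"
      proof
        assume "(u, v) \<in> iso_arcs h ` arcs H"
        then obtain e where e: "e \<in> arcs G" "tail G e \<in> f ` V" "head G e \<in> f ` V"
          "u = g (tail G e)" "v = g (head G e)"
          by (auto simp: arcsH h_def)
        then show "u \<in> V \<and> v \<in> V \<and> f u \<rightarrow>\<^bsub>G\<^esub> f v"
          using gV by (auto simp: arcs_ends_conv)
      next
        assume "u \<in> V \<and> v \<in> V \<and> f u \<rightarrow>\<^bsub>G\<^esub> f v"
        then obtain e where "u \<in> V" "v \<in> V" "e \<in> arcs G" "tail G e = f u" "head G e = f v"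
          by (auto simp: arcs_ends_conv)
        then show "(u, v) \<in> iso_arcs h ` arcs H"
          by (intro image_eqI[of _ _ e]) (auto simp: arcsH h_def gf)
      qed
      then show "(u, v) \<in> arcs (edge_graph V E) \<longleftrightarrow> (u, v) \<in> arcs (app_iso h H)"
        using adj E by (auto simp: edge_graph_def)
    qed
  qed (auto simp: edge_graph_def h_def)
  ultimately have "digraph_iso H (edge_graph V E)"
    by (auto simp: digraph_iso_def)
  with free F H show False
    by (auto simp: free_of_def)
qed

context Digraph.graph
begin

lemma adj_sym: "u \<rightarrow>\<^bsub>G\<^esub> v \<longleftrightarrow> v \<rightarrow>\<^bsub>G\<^esub> u"
  using arcs_ends_symmetric[OF sym_arcs] by blast

lemma not_adj_refl: "\<not> v \<rightarrow>\<^bsub>G\<^esub> v"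
  using adj_not_same by blast

lemma butterfly_free:
  assumes "free_of \<F> G" "butterfly \<in> \<F>"
    and "x \<rightarrow>\<^bsub>G\<^esub> a" "x \<rightarrow>\<^bsub>G\<^esub> b" "a \<rightarrow>\<^bsub>G\<^esub> b" "x \<rightarrow>\<^bsub>G\<^esub> c" "x \<rightarrow>\<^bsub>G\<^esub> d" "c \<rightarrow>\<^bsub>G\<^esub> d"
    and "\<not> a \<rightarrow>\<^bsub>G\<^esub> c" "\<not> a \<rightarrow>\<^bsub>G\<^esub> d" "\<not> b \<rightarrow>\<^bsub>G\<^esub> c" "\<not> b \<rightarrow>\<^bsub>G\<^esub> d"
  shows False
proof (rule edge_graph_not_free)
  let ?f = "\<lambda>n::nat. [x, a, b, c, d] ! n"
  have rev: "a \<rightarrow>\<^bsub>G\<^esub> x" "b \<rightarrow>\<^bsub>G\<^esub> x" "b \<rightarrow>\<^bsub>G\<^esub> a" "c \<rightarrow>\<^bsub>G\<^esub> x" "d \<rightarrow>\<^bsub>G\<^esub> x" "d \<rightarrow>\<^bsub>G\<^esub> c"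
      "\<not> c \<rightarrow>\<^bsub>G\<^esub> a" "\<not> d \<rightarrow>\<^bsub>G\<^esub> a" "\<not> c \<rightarrow>\<^bsub>G\<^esub> b" "\<not> d \<rightarrow>\<^bsub>G\<^esub> b"
    using assms(3-) adj_sym by blast+
  \<comment> \<open>The pattern itself separates the vertices: \<open>a = c\<close>, for instance,
    would turn the edge \<open>c d\<close> into the excluded \<open>a d\<close>.\<close>
  have ne: "distinct [x, a, b, c, d]"
    using assms(3-) not_adj_refl adj_sym by auto
  show "edge_graph {0,1,2,3,4} {(0,1), (0,2), (1,2), (0,3), (0,4), (3,4)} \<in> \<F>"
    using assms(2) by (simp add: butterfly_def)
  show "inj_on ?f {0,1,2,3,4}"
    using ne by (auto simp: inj_on_def)
  show "?f ` {0,1,2,3,4} \<subseteq> verts G"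
    using assms(3-8) by (auto dest: adj_in_verts)
  show "?f u \<rightarrow>\<^bsub>G\<^esub> ?f v \<longleftrightarrow> (u, v) \<in> {(0,1), (0,2), (1,2), (0,3), (0,4), (3,4)} \<union>
      {(0,1), (0,2), (1,2), (0,3), (0,4), (3,4)}\<inverse>" if "u \<in> {0,1,2,3,4}" "v \<in> {0,1,2,3,4}" for u v
    using that
    by (elim insertE emptyE; simp add: assms(3-) rev not_adj_refl)
qed (use assms graph_axioms in auto)

lemma hammer_free:
  assumes "free_of \<F> G" "hammer \<in> \<F>"
    and "a \<rightarrow>\<^bsub>G\<^esub> b" "b \<rightarrow>\<^bsub>G\<^esub> c" "a \<rightarrow>\<^bsub>G\<^esub> c" "c \<rightarrow>\<^bsub>G\<^esub> d" "d \<rightarrow>\<^bsub>G\<^esub> e"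
    and "\<not> a \<rightarrow>\<^bsub>G\<^esub> d" "\<not> a \<rightarrow>\<^bsub>G\<^esub> e" "\<not> b \<rightarrow>\<^bsub>G\<^esub> d" "\<not> b \<rightarrow>\<^bsub>G\<^esub> e" "\<not> c \<rightarrow>\<^bsub>G\<^esub> e"
  shows False
proof (rule edge_graph_not_free)
  let ?f = "\<lambda>n::nat. [a, b, c, d, e] ! n"
  have rev: "b \<rightarrow>\<^bsub>G\<^esub> a" "c \<rightarrow>\<^bsub>G\<^esub> b" "c \<rightarrow>\<^bsub>G\<^esub> a" "d \<rightarrow>\<^bsub>G\<^esub> c" "e \<rightarrow>\<^bsub>G\<^esub> d"
      "\<not> d \<rightarrow>\<^bsub>G\<^esub> a" "\<not> e \<rightarrow>\<^bsub>G\<^esub> a" "\<not> d \<rightarrow>\<^bsub>G\<^esub> b" "\<not> e \<rightarrow>\<^bsub>G\<^esub> b" "\<not> e \<rightarrow>\<^bsub>G\<^esub> c"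
    using assms(3-) adj_sym by blast+
  have ne: "distinct [a, b, c, d, e]"
    using assms(3-) not_adj_refl adj_sym by auto
  show "edge_graph {0,1,2,3,4} {(0,1), (1,2), (0,2), (2,3), (3,4)} \<in> \<F>"
    using assms(2) by (simp add: hammer_def)
  show "inj_on ?f {0,1,2,3,4}"
    using ne by (auto simp: inj_on_def)
  show "?f ` {0,1,2,3,4} \<subseteq> verts G"
    using assms(3-7) by (auto dest: adj_in_verts)
  show "?f u \<rightarrow>\<^bsub>G\<^esub> ?f v \<longleftrightarrow> (u, v) \<in> {(0,1), (1,2), (0,2), (2,3), (3,4)} \<union>
      {(0,1), (1,2), (0,2), (2,3), (3,4)}\<inverse>" if "u \<in> {0,1,2,3,4}" "v \<in> {0,1,2,3,4}" for u v
    using that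
    by (elim insertE emptyE; simp add: assms(3-) rev not_adj_refl)
qed (use assms graph_axioms in auto)

text \<open>Here \<open>v\<close> is the \<open>K_1\<close>, the edge \<open>x y\<close> the
  \<open>K_2\<close> and \<open>T\<close> the \<open>K_p\<close>; all adjacencies except those at
  \<open>v\<close> come from a single clique.\<close>

lemma K1_K2_join_K_free:
  assumes "free_of \<F> G" "K1_K2_join_K (card T) \<in> \<F>" "finite T"
    and Q: "clique G (T \<union> {x, y})" and x: "x \<notin> T" "y \<notin> T" "x \<noteq> y"
    and v: "v \<in> verts G" "v \<noteq> x" "v \<noteq> y" "\<not> v \<rightarrow>\<^bsub>G\<^esub> x" "\<not> v \<rightarrow>\<^bsub>G\<^esub> y"
    and vT: "\<And>t. t \<in> T \<Longrightarrow> v \<rightarrow>\<^bsub>G\<^esub> t"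
  shows False
proof -
  let ?p = "card T"
  obtain h where h: "bij_betw h {0..<?p} T"
    using \<open>finite T\<close> ex_bij_betw_nat_finite by blast
  \<comment> \<open>The numbering is that of \<open>K1_K2_join_K_eq\<close>: 0 is the
    \<open>K_1\<close>, 1 and 2 form the \<open>K_2\<close>, and the numbers from 3 on form the
    \<open>K_p\<close>, hence the shift by 3.\<close>
  define f where "f n = (if n = 0 then v else if n = 1 then x else if n = 2 then y else h (n - 3))"
    for n :: nat
  let ?V = "{0..<3 + ?p}" and ?E = "{(1, 2)} \<union> {(u, v). u < v \<and> 3 \<le> v \<and> v < 3 + ?p}"
  have f: "f 0 = v" "f (Suc 0) = x" "f 2 = y" "\<And>n. 3 \<le> n \<Longrightarrow> f n = h (n - 3)"
    by (simp_all add: f_def)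
  have hT: "h (n - 3) \<in> T" if "3 \<le> n" "n < 3 + ?p" for n
    using bij_betwE[OF h] that by auto
  have hinj: "h (m - 3) = h (n - 3) \<longleftrightarrow> m = n" if "3 \<le> m" "m < 3 + ?p" "3 \<le> n" "n < 3 + ?p" for m n
    using inj_on_eq_iff[OF bij_betw_imp_inj_on[OF h], of "m - 3" "n - 3"] that by auto
  have V: "n = 0 \<or> n = 1 \<or> n = 2 \<or> 3 \<le> n \<and> n < 3 + ?p" if "n \<in> ?V" for n
    using that by auto
  have vT': "v \<notin> T"
    using vT not_adj_refl by blast
  have F: "edge_graph ?V ?E \<in> \<F>"
    using assms(2) by (simp add: K1_K2_join_K_eq)
  have inj: "inj_on f ?V"
  proof (rule inj_onI)
    fix m n assume mn: "m \<in> ?V" "n \<in> ?V" "f m = f n"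
    have ne: "h (k - 3) \<noteq> v \<and> h (k - 3) \<noteq> x \<and> h (k - 3) \<noteq> y" if "3 \<le> k" "k < 3 + ?p" for k
      using hT[OF that] x vT' by auto
    from V[OF mn(1)] V[OF mn(2)] mn(3) show "m = n"
      using ne[of m] ne[of n] hinj x v(2,3) by (elim disjE conjE) (auto simp: f)
  qed
  have TV: "T \<union> {x, y} \<subseteq> verts G"
    using Q by (simp add: clique_def)
  have sub: "f ` ?V \<subseteq> verts G"
  proof clarify
    fix n assume "n \<in> ?V"
    from V[OF this] show "f n \<in> verts G"
      using TV v(1) hT by (elim disjE conjE) (auto simp: f)
  qed
  have adj: "f m \<rightarrow>\<^bsub>G\<^esub> f n \<longleftrightarrow> (m, n) \<in> ?E \<union> ?E\<inverse>" if mn: "m \<in> ?V" "n \<in> ?V" for m n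
  proof -
    have adjQ: "a \<rightarrow>\<^bsub>G\<^esub> b \<longleftrightarrow> a \<noteq> b" if "a \<in> T \<union> {x, y}" "b \<in> T \<union> {x, y}" for a b
      using Q that not_adj_refl by (auto simp: clique_def)
    \<comment> \<open>The pattern lists each edge with its smaller end first, so the case
      \<open>m \<le> n\<close> is checked directly and symmetry gives the other one.\<close>
    have le: "f m \<rightarrow>\<^bsub>G\<^esub> f n \<longleftrightarrow> (m, n) \<in> ?E \<union> ?E\<inverse>" if "m \<in> ?V" "n \<in> ?V" "m \<le> n" for m n
    proof -
      from V[OF that(1)] V[OF that(2)] show ?thesis
        using \<open>m \<le> n\<close> v(4,5) x vT not_adj_refl hT[of m] hT[of n] hinj[of m n]
        by (elim disjE conjE) (auto simp: f adjQ)
    qed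
    show ?thesis
      using le[OF mn] le[OF mn(2) mn(1)] adj_sym[of "f m" "f n"] by (cases "m \<le> n") auto
  qed
  show False
    by (rule edge_graph_not_free[OF graph_axioms assms(1) F _ inj sub adj]) auto
qed

section \<open>Cliques, colourings and perfection\<close>

lemma finite_cliques: "finite {card S | S. clique G S}"
proof -
  have "{card S | S. clique G S} \<subseteq> card ` Pow (verts G)"
    by (auto simp: clique_def)
  then show ?thesis
    by (rule finite_subset) simp
qed

lemma card_clique_le: "clique G S \<Longrightarrow> card S \<le> clique_number G"
  unfolding clique_number_def by (rule Max_ge[OF finite_cliques]) auto

lemma maximum_clique_exists:
  obtains K where "clique G K" "card K = clique_number G"
proof -
  have "clique G {}"
    by (simp add: clique_def)
  then have "clique_number G \<in> {card S | S. clique G S}"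
    unfolding clique_number_def by (intro Max_in finite_cliques) auto
  then show thesis
    using that by auto
qed

text \<open>A proper colouring is injective on every clique, so no clique is larger than the number
  of colours. A clique and a colouring of equal size are therefore both optimal.\<close>

lemma chromatic_number_eq_clique_number:
  assumes S: "clique G S" and c: "proper_coloring G (card S) c"
  shows "chromatic_number G = clique_number G"
proof -
  have le: "card T \<le> k" if T: "clique G T" and k: "proper_coloring G k d" for T k d
  proof -
    have "inj_on d T"
      using T k by (fastforce simp: clique_def proper_coloring_def inj_on_def)
    moreover have "d ` T \<subseteq> {..<k}"
      using T k by (auto simp: clique_def proper_coloring_def)
    ultimately show ?thesis
      using card_inj_on_le[of d T "{..<k}"] by simp
  qed
  have "chromatic_number G = card S"
    unfolding chromatic_number_def using c le[OF S] by (intro Least_equality) auto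
  moreover have "clique_number G = card S"
    by (metis S c card_clique_le le maximum_clique_exists order_antisym)
  ultimately show ?thesis
    by simp
qed

text \<open>The structure passes to induced subgraphs \<open>H\<close>. The parts of
  \<open>M\<close> that \<open>H\<close> meets give a clique and colours; whether one more colour is
  needed depends on whether some vertex outside \<open>M\<close> has neighbours in all of these
  parts.\<close>

lemma perfect_multipartite_independent:
  fixes c :: "'a \<Rightarrow> 'c"
  assumes M: "\<And>u v. u \<in> M \<Longrightarrow> v \<in> M \<Longrightarrow> u \<rightarrow>\<^bsub>G\<^esub> v \<longleftrightarrow> c u \<noteq> c v"
    and R: "\<And>u v. u \<in> verts G - M \<Longrightarrow> v \<in> verts G - M \<Longrightarrow> \<not> u \<rightarrow>\<^bsub>G\<^esub> v"
  shows "perfect_graph G"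
  unfolding perfect_graph_def
proof (intro allI impI)
  fix H assume HG: "induced_subgraph H G"
  have "digraph H" "sym_digraph H"
    using HG digraphI_induced induced_graph_imp_graph by blast+
  then interpret H: Digraph.graph H
    by (intro Digraph.graph.intro pseudo_graph.intro) (simp_all add: digraph_def)
  have sub: "verts H \<subseteq> verts G"
    using HG by (auto simp: induced_subgraph_def subgraph_def)
  have adj: "u \<rightarrow>\<^bsub>H\<^esub> v \<longleftrightarrow> u \<rightarrow>\<^bsub>G\<^esub> v" if "u \<in> verts H" "v \<in> verts H" for u v
  proof -
    have "tail H = tail G" "head H = head G"
      using HG by (simp_all add: induced_subgraph_def subgraph_def compatible_def)
    moreover have "arcs H = {e \<in> arcs G. tail G e \<in> verts H \<and> head G e \<in> verts H}"
      using HG by (simp add: induced_subgraph_def)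
    ultimately show ?thesis
      using that by (auto simp: arcs_ends_conv)
  qed
  let ?P = "c ` (verts H \<inter> M)"
  obtain h where h: "bij_betw h ?P {0..<card ?P}"
    using ex_bij_betw_finite_nat[of ?P] by auto
  have hlt: "h (c u) < card ?P" if "u \<in> verts H" "u \<in> M" for u
    using bij_betwE[OF h] that by auto
  have hinj: "h a = h b \<longleftrightarrow> a = b" if "a \<in> ?P" "b \<in> ?P" for a b
    using inj_on_eq_iff[OF bij_betw_imp_inj_on[OF h]] that by blast
  define meets where "meets v q \<longleftrightarrow> (\<exists>u \<in> verts H \<inter> M. c u = q \<and> v \<rightarrow>\<^bsub>G\<^esub> u)" for v q
  show "chromatic_number H = clique_number H"
  \<comment> \<open>Degenerate cases fit this split: if \<open>H\<close> has vertices but none in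
    \<open>M\<close>, the inner quantifier is vacuous and one colour results; the empty
    \<open>H\<close> falls into the second case with no colours.\<close>
  proof (cases "\<exists>v \<in> verts H - M. \<forall>q \<in> ?P. meets v q")
    case True
    then obtain v where v: "v \<in> verts H" "v \<notin> M" and "\<forall>q \<in> ?P. \<exists>u \<in> verts H \<inter> M. c u = q \<and> v \<rightarrow>\<^bsub>G\<^esub> u"
      by (auto simp: meets_def)
    then obtain f where f: "\<And>q. q \<in> ?P \<Longrightarrow> f q \<in> verts H \<inter> M \<and> c (f q) = q \<and> v \<rightarrow>\<^bsub>G\<^esub> f q"
      by metis
    have "inj_on f ?P"
      using f by (metis inj_onI)
    then have "card (f ` ?P) = card ?P"
      by (rule card_image)
    moreover have "v \<notin> f ` ?P"
      using f v by blast
    ultimately have card: "card (insert v (f ` ?P)) = Suc (card ?P)"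
      by simp
    have "clique H (insert v (f ` ?P))"
      unfolding clique_def
    proof (intro conjI ballI impI)
      show "insert v (f ` ?P) \<subseteq> verts H"
        using v f by blast
      have fP: "w \<in> verts H" "w \<in> M" "v \<rightarrow>\<^bsub>G\<^esub> w" if "w \<in> f ` ?P" for w
        using f that by blast+
      have ff: "c a \<noteq> c b" if "a \<in> f ` ?P" "b \<in> f ` ?P" "a \<noteq> b" for a b
        using f that by (metis imageE)
      fix a b assume "a \<in> insert v (f ` ?P)" "b \<in> insert v (f ` ?P)" "a \<noteq> b"
      then show "a \<rightarrow>\<^bsub>H\<^esub> b"
        using fP ff M adj adj_sym v(1) by (metis insertE)
    qed
    \<comment> \<open>The vertices outside \<open>M\<close> are pairwise non-adjacent and share the
      additional colour \<open>card ?P\<close>.\<close>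
    moreover have "proper_coloring H (Suc (card ?P)) (\<lambda>u. if u \<in> M then h (c u) else card ?P)"
      unfolding proper_coloring_def
    proof (intro conjI ballI; clarify?)
      fix u assume "u \<in> verts H"
      then show "(if u \<in> M then h (c u) else card ?P) < Suc (card ?P)"
        using hlt by (auto simp: less_Suc_eq)
    next
      fix u w assume uw: "u \<rightarrow>\<^bsub>H\<^esub> w"
        and eq: "(if u \<in> M then h (c u) else card ?P) = (if w \<in> M then h (c w) else card ?P)"
      have V: "u \<in> verts H" "w \<in> verts H"
        using uw by (auto dest: H.adj_in_verts)
      then have "u \<rightarrow>\<^bsub>G\<^esub> w"
        using adj uw by blast
      then show False
        using eq V M[of u w] R[of u w] hlt[of u] hlt[of w] hinj[of "c u" "c w"] sub
        by (auto split: if_splits)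
    qed
    ultimately show ?thesis
      using H.chromatic_number_eq_clique_number card by metis
  next
    case False
    \<comment> \<open>Each vertex outside \<open>M\<close> now has a part in which it has no
      neighbour; \<open>d\<close> selects one, and its colour is reused.\<close>
    then obtain d where d: "\<And>v. v \<in> verts H - M \<Longrightarrow> d v \<in> ?P \<and> \<not> meets v (d v)"
      by metis
    have "\<exists>x. x \<in> verts H \<inter> M \<and> c x = q" if "q \<in> ?P" for q
      using that by blast
    then obtain f where f: "\<And>q. q \<in> ?P \<Longrightarrow> f q \<in> verts H \<inter> M \<and> c (f q) = q"
      by metis
    have "inj_on f ?P"
      using f by (metis inj_onI)
    then have card: "card (f ` ?P) = card ?P"
      by (rule card_image)
    have "clique H (f ` ?P)"
      unfolding clique_def
    proof (intro conjI ballI impI)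
      show "f ` ?P \<subseteq> verts H"
        using f by blast
      fix a b assume ab: "a \<in> f ` ?P" "b \<in> f ` ?P" "a \<noteq> b"
      then have "a \<in> verts H" "a \<in> M" "b \<in> verts H" "b \<in> M"
        using f by blast+
      moreover have "c a \<noteq> c b"
        using f ab by (metis imageE)
      ultimately show "a \<rightarrow>\<^bsub>H\<^esub> b"
        using M adj by blast
    qed
    moreover have "proper_coloring H (card ?P) (\<lambda>u. if u \<in> M then h (c u) else h (d u))"
      unfolding proper_coloring_def
    proof (intro conjI ballI; clarify?)
      fix u assume "u \<in> verts H"
      then show "(if u \<in> M then h (c u) else h (d u)) < card ?P"
        using hlt d[of u] by auto
    next
      fix u w assume uw: "u \<rightarrow>\<^bsub>H\<^esub> w"
        and eq: "(if u \<in> M then h (c u) else h (d u)) = (if w \<in> M then h (c w) else h (d w))"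
      have V: "u \<in> verts H" "w \<in> verts H"
        using uw by (auto dest: H.adj_in_verts)
      then have "u \<rightarrow>\<^bsub>G\<^esub> w" "w \<rightarrow>\<^bsub>G\<^esub> u"
        using adj uw adj_sym by blast+
      have P: "c x \<in> ?P" if "x \<in> verts H" "x \<in> M" for x
        using that by blast
      show False
      proof (cases "u \<in> M"; cases "w \<in> M")
        assume "u \<in> M" "w \<in> M"
        then show False
          using eq V P hinj M \<open>u \<rightarrow>\<^bsub>G\<^esub> w\<close> by auto
      next
        assume "u \<in> M" "w \<notin> M"
        then have "d w = c u"
          using eq V P hinj[of "c u" "d w"] d[of w] by auto
        then show False
          using d[of w] V \<open>u \<in> M\<close> \<open>w \<notin> M\<close> \<open>w \<rightarrow>\<^bsub>G\<^esub> u\<close> by (auto simp: meets_def)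
      next
        assume "u \<notin> M" "w \<in> M"
        then have "d u = c w"
          using eq V P hinj[of "d u" "c w"] d[of u] by auto
        then show False
          using d[of u] V \<open>u \<notin> M\<close> \<open>w \<in> M\<close> \<open>u \<rightarrow>\<^bsub>G\<^esub> w\<close> by (auto simp: meets_def)
      next
        assume "u \<notin> M" "w \<notin> M"
        then show False
          using R V sub \<open>u \<rightarrow>\<^bsub>G\<^esub> w\<close> by blast
      qed
    qed
    ultimately show ?thesis
      using H.chromatic_number_eq_clique_number card by metis
  qed
qed

end

section \<open>The complete multipartite graph around a maximum clique\<close>

locale maximum_clique = Digraph.graph G for G :: "('a, 'b) pre_digraph" (structure) +
  fixes p :: nat and K :: "'a set"
  assumes free: "free_of {butterfly, hammer, K1_K2_join_K p} G"
    and K: "clique G K" "card K = clique_number G"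
    and ge_2p: "2 * p \<le> clique_number G" and ge_p2: "p + 2 \<le> clique_number G"
begin

lemma clique_finite: "clique G Q \<Longrightarrow> finite Q"
  using finite_subset[OF _ finite_verts] by (auto simp: clique_def)

lemma clique_adj: "clique G Q \<Longrightarrow> a \<in> Q \<Longrightarrow> b \<in> Q \<Longrightarrow> a \<rightarrow>\<^bsub>G\<^esub> b \<longleftrightarrow> a \<noteq> b"
  using not_adj_refl by (auto simp: clique_def)

lemma K_adj: "a \<in> K \<Longrightarrow> b \<in> K \<Longrightarrow> a \<rightarrow>\<^bsub>G\<^esub> b \<longleftrightarrow> a \<noteq> b"
  using clique_adj[OF K(1)] .

lemma K_finite: "finite K"
  using clique_finite[OF K(1)] .

lemma K_verts: "K \<subseteq> verts G"
  using K(1) by (simp add: clique_def)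

text \<open>With at least \<open>p\<close> neighbours and two non-neighbours in \<open>Q\<close>,
  the vertex \<open>v\<close>, these two and \<open>p\<close> of the neighbours would induce the
  forbidden join. Since \<open>p + 2 \<le> clique_number G\<close>, at least the values
  \<open>p\<close> to \<open>clique_number G - 2\<close> are excluded, so a count changing by one
  cannot cross the gap.\<close>

lemma nbrs_dichotomy:
  assumes Q: "clique G Q" "card Q = clique_number G" and v: "v \<in> verts G"
  shows "card {q \<in> Q. v \<rightarrow>\<^bsub>G\<^esub> q} < p \<or> clique_number G - 1 \<le> card {q \<in> Q. v \<rightarrow>\<^bsub>G\<^esub> q}"
proof (rule ccontr)
  let ?N = "{q \<in> Q. v \<rightarrow>\<^bsub>G\<^esub> q}"
  assume "\<not> ?thesis"
  then have ge: "p \<le> card ?N" and lt: "card ?N < clique_number G - 1"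
    by auto
  have fin: "finite Q"
    using Q(1) by (rule clique_finite)
  have "v \<notin> Q"
  proof
    assume "v \<in> Q"
    then have "?N = Q - {v}"
      using clique_adj[OF Q(1)] by auto
    with \<open>v \<in> Q\<close> fin Q(2) lt show False
      by simp
  qed
  have "card (Q - ?N) = card Q - card ?N"
    using fin by (intro card_Diff_subset) auto
  then have "2 \<le> card (Q - ?N)"
    using lt Q(2) by linarith
  then obtain P where "P \<subseteq> Q - ?N" "card P = 2"
    by (meson obtain_subset_with_card_n)
  then obtain x y where xy: "x \<in> Q" "y \<in> Q" "\<not> v \<rightarrow>\<^bsub>G\<^esub> x" "\<not> v \<rightarrow>\<^bsub>G\<^esub> y" "x \<noteq> y"
    by (auto simp: card_2_iff)
  obtain T where T: "T \<subseteq> ?N" "card T = p"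
    using ge by (meson obtain_subset_with_card_n)
  show False
  proof (rule K1_K2_join_K_free[OF free])
    show "K1_K2_join_K (card T) \<in> {butterfly, hammer, K1_K2_join_K p}"
      using T by simp
    show "finite T"
      using T fin by (auto intro: finite_subset)
    show "clique G (T \<union> {x, y})"
      using Q(1) T(1) xy unfolding clique_def by blast
    show "x \<notin> T" "y \<notin> T" "x \<noteq> y" "v \<noteq> x" "v \<noteq> y"
      using T(1) xy \<open>v \<notin> Q\<close> by auto
    show "v \<rightarrow>\<^bsub>G\<^esub> t" if "t \<in> T" for t
      using T(1) that by auto
  qed (use xy v in auto)
qed

definition misses :: "'a \<Rightarrow> 'a \<Rightarrow> bool" where
  "misses v k \<longleftrightarrow> v \<in> verts G \<and> k \<in> K \<and> (\<forall>j\<in>K. v \<rightarrow>\<^bsub>G\<^esub> j \<longleftrightarrow> j \<noteq> k)"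

definition M :: "'a set" where
  "M = {v. \<exists>k. misses v k}"

text \<open>The parts are labelled by the vertices of \<open>K\<close>. For \<open>v\<close> in
  \<open>M\<close> the label is unique, as the only non-neighbour of \<open>v\<close> in
  \<open>K\<close>; elsewhere it is unspecified.\<close>

definition part :: "'a \<Rightarrow> 'a" where
  "part v = (THE k. misses v k)"

lemma part_eqI: "misses v k \<Longrightarrow> part v = k"
  unfolding part_def by (rule the_equality) (auto simp: misses_def)

lemma misses_part: "v \<in> M \<Longrightarrow> misses v (part v)"
  using part_eqI by (auto simp: M_def)

lemma part_in_K: "v \<in> M \<Longrightarrow> part v \<in> K"
  using misses_part by (simp add: misses_def)

lemma adj_K: "v \<in> M \<Longrightarrow> k \<in> K \<Longrightarrow> v \<rightarrow>\<^bsub>G\<^esub> k \<longleftrightarrow> k \<noteq> part v"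
  using misses_part by (simp add: misses_def)

lemma M_verts: "M \<subseteq> verts G"
  by (auto simp: M_def misses_def)

lemma K_in_M: "k \<in> K \<Longrightarrow> k \<in> M \<and> part k = k"
proof -
  assume "k \<in> K"
  then have "misses k k"
    using K_adj K_verts by (auto simp: misses_def)
  then show ?thesis
    using part_eqI by (auto simp: M_def)
qed

text \<open>Supplies further maximum cliques to which \<open>nbrs_dichotomy\<close> applies. For
  \<open>u\<close> in \<open>K\<close> the swap changes nothing, because then
  \<open>part u = u\<close>.\<close>

lemma clique_swap:
  assumes "u \<in> M"
  shows "clique G (insert u (K - {part u}))" "card (insert u (K - {part u})) = clique_number G"
proof -
  show "clique G (insert u (K - {part u}))"
    unfolding clique_def
  proof (intro conjI ballI impI)
    show "insert u (K - {part u}) \<subseteq> verts G"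
      using K_verts M_verts assms by auto
    fix a b assume "a \<in> insert u (K - {part u})" "b \<in> insert u (K - {part u})" "a \<noteq> b"
    then show "a \<rightarrow>\<^bsub>G\<^esub> b"
      using adj_K[OF assms] K_adj adj_sym[of u] by auto
  qed
  have "u \<notin> K - {part u}"
    using K_in_M by auto
  then have "card (insert u (K - {part u})) = Suc (card K - 1)"
    using part_in_K[OF assms] K_finite by simp
  then show "card (insert u (K - {part u})) = clique_number G"
    using K(2) ge_p2 by simp
qed

text \<open>Two adjacent vertices of one part would enlarge a swapped clique beyond the maximum; two
  non-adjacent vertices of different parts would violate the dichotomy for a swapped clique.\<close>

lemma M_multipartite:
  assumes u: "u \<in> M" and w: "w \<in> M"
  shows "u \<rightarrow>\<^bsub>G\<^esub> w \<longleftrightarrow> part u \<noteq> part w"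
proof
  assume uw: "u \<rightarrow>\<^bsub>G\<^esub> w"
  show "part u \<noteq> part w"
  proof
    assume eq: "part u = part w"
    let ?Q = "insert u (K - {part u})"
    have w': "w \<notin> ?Q"
      using uw not_adj_refl adj_K[OF u] K_in_M eq by auto
    have "w \<rightarrow>\<^bsub>G\<^esub> q" if "q \<in> ?Q" for q
      using that uw adj_sym adj_K[OF w] eq by auto
    then have "clique G (insert w ?Q)"
      using clique_swap(1)[OF u] w M_verts adj_sym[of w] unfolding clique_def by blast
    then have "card (insert w ?Q) \<le> clique_number G"
      by (rule card_clique_le)
    then show False
      using card_insert_disjoint[OF clique_finite[OF clique_swap(1)[OF u]] w'] clique_swap(2)[OF u]
        by linarith
  qed
next
  assume ne: "part u \<noteq> part w"
  let ?Q = "insert u (K - {part u})"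
  show "u \<rightarrow>\<^bsub>G\<^esub> w"
  proof (rule ccontr)
    assume "\<not> u \<rightarrow>\<^bsub>G\<^esub> w"
    then have "\<not> w \<rightarrow>\<^bsub>G\<^esub> u"
      using adj_sym by blast
    \<comment> \<open>In the swapped clique \<open>w\<close> fails to see both \<open>u\<close> and
      \<open>part w\<close>, which leaves \<open>clique_number G - 2\<close> neighbours, a value
      inside the gap.\<close>
    then have "{q \<in> ?Q. w \<rightarrow>\<^bsub>G\<^esub> q} = K - {part u, part w}"
      using adj_K[OF w] by auto
    moreover have "card (K - {part u, part w}) = clique_number G - 2"
      using ne part_in_K u w K(2) K_finite by (simp add: card_Diff_subset)
    ultimately have "card {q \<in> ?Q. w \<rightarrow>\<^bsub>G\<^esub> q} = clique_number G - 2"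
      by (simp only:)
    then show False
      using nbrs_dichotomy[OF clique_swap[OF u] subsetD[OF M_verts w]] ge_p2 by linarith
  qed
qed

section \<open>Vertices outside the multipartite graph\<close>

text \<open>The upper alternative of the dichotomy is impossible: a vertex seeing all of
  \<open>K\<close> would extend it, and one seeing all but one vertex would lie in
  \<open>M\<close>.\<close>

lemma few_nbrs:
  assumes v: "v \<in> verts G - M"
  shows "card {k \<in> K. v \<rightarrow>\<^bsub>G\<^esub> k} < p"
proof (rule ccontr)
  let ?N = "{k \<in> K. v \<rightarrow>\<^bsub>G\<^esub> k}"
  assume "\<not> ?thesis"
  then have ge: "clique_number G - 1 \<le> card ?N"
    using nbrs_dichotomy[OF K] v by auto
  have "card (K - ?N) = card K - card ?N"
    using K_finite by (intro card_Diff_subset) auto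
  moreover have "card ?N \<noteq> card K"
  proof
    assume "card ?N = card K"
    then have "?N = K"
      using K_finite by (intro card_subset_eq) auto
    then have all: "\<And>k. k \<in> K \<Longrightarrow> v \<rightarrow>\<^bsub>G\<^esub> k"
      by blast
    have "clique G (insert v K)"
      using all K(1) v adj_sym[of v] unfolding clique_def by blast
    then have "card (insert v K) \<le> clique_number G"
      by (rule card_clique_le)
    moreover have "v \<notin> K"
      using all not_adj_refl by blast
    ultimately show False
      using K_finite K(2) by simp
  qed
  moreover have "card ?N \<le> card K"
    using K_finite by (intro card_mono) auto
  ultimately have "card (K - ?N) = 1"
    using ge K(2) by linarith
  then obtain k where "K - ?N = {k}"
    by (auto simp: card_1_singleton_iff)
  then have "misses v k"
    using v unfolding misses_def by blast
  then show False
    using v by (auto simp: M_def)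
qed

text \<open>The set \<open>S\<close> records which vertices of \<open>K\<close> have been exchanged
  for the choice \<open>f\<close>. Every intermediate transversal is a maximum clique by
  \<open>M_multipartite\<close>, so induction on \<open>S\<close> can use the gap in the
  dichotomy.\<close>

lemma few_nbrs_transversal:
  assumes v: "v \<in> verts G - M" and f: "\<And>k. k \<in> K \<Longrightarrow> f k \<in> M \<and> part (f k) = k"
    and S: "S \<subseteq> K"
  shows "card {k \<in> K. v \<rightarrow>\<^bsub>G\<^esub> (if k \<in> S then f k else k)} < p"
proof -
  define g where "g S k = (if k \<in> S then f k else k)" for S k
  have "finite S"
    using S K_finite by (rule finite_subset)
  then have "card {k \<in> K. v \<rightarrow>\<^bsub>G\<^esub> g S k} < p"
    using S
  proof (induction S rule: finite_induct)
    case empty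
    then show ?case
      using few_nbrs[OF v] by (simp add: g_def)
  next
    case (insert s S)
    let ?g = "g (insert s S)"
    have g: "?g k \<in> M" "part (?g k) = k" if "k \<in> K" for k
      using f[OF that] K_in_M[OF that] by (auto simp: g_def)
    have inj: "inj_on ?g K"
      by (rule inj_on_inverseI[of _ part]) (rule g)
    have Q: "clique G (?g ` K)"
      unfolding clique_def using g M_verts M_multipartite by force
    have card: "card (?g ` K) = clique_number G"
      using card_image[OF inj] K(2) by simp
    have "{q \<in> ?g ` K. v \<rightarrow>\<^bsub>G\<^esub> q} = ?g ` {k \<in> K. v \<rightarrow>\<^bsub>G\<^esub> ?g k}"
      by auto
    also have "card \<dots> = card {k \<in> K. v \<rightarrow>\<^bsub>G\<^esub> ?g k}"
      using inj by (intro card_image) (auto intro: inj_on_subset)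
    finally have eq: "card {q \<in> ?g ` K. v \<rightarrow>\<^bsub>G\<^esub> q} = card {k \<in> K. v \<rightarrow>\<^bsub>G\<^esub> ?g k}" .
    \<comment> \<open>Only the representative of part \<open>s\<close> changes, so the count rises
      by at most one, from below \<open>p\<close> to at most \<open>p\<close>; the dichotomy then
      pushes it back below \<open>p\<close>.\<close>
    have "{k \<in> K. v \<rightarrow>\<^bsub>G\<^esub> ?g k} \<subseteq> insert s {k \<in> K. v \<rightarrow>\<^bsub>G\<^esub> g S k}"
      by (auto simp: g_def)
    then have "card {k \<in> K. v \<rightarrow>\<^bsub>G\<^esub> ?g k} \<le> card (insert s {k \<in> K. v \<rightarrow>\<^bsub>G\<^esub> g S k})"
      using K_finite by (intro card_mono) auto
    also have "\<dots> \<le> Suc (card {k \<in> K. v \<rightarrow>\<^bsub>G\<^esub> g S k})"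
      by (rule card_insert_le_m1) auto
    also have "\<dots> \<le> p"
      using insert by auto
    finally show ?case
      using nbrs_dichotomy[OF Q card, of v] v ge_p2 eq by auto
  qed
  then show ?thesis
    by (simp add: g_def)
qed

definition touched :: "'a \<Rightarrow> 'a set" where
  "touched v = part ` {x \<in> M. v \<rightarrow>\<^bsub>G\<^esub> x}"

lemma touched_K: "touched v \<subseteq> K"
  using part_in_K by (auto simp: touched_def)

lemma card_touched:
  assumes v: "v \<in> verts G - M"
  shows "card (touched v) < p"
proof -
  \<comment> \<open>The transversal takes a neighbour of \<open>v\<close> in every touched part, so
    that its neighbours account for all touched parts at once.\<close>
  have "\<exists>x. x \<in> M \<and> part x = k \<and> (k \<in> touched v \<longrightarrow> v \<rightarrow>\<^bsub>G\<^esub> x)" if "k \<in> K" for k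
    using K_in_M[OF that] by (auto simp: touched_def)
  then obtain f where f: "\<And>k. k \<in> K \<Longrightarrow> f k \<in> M \<and> part (f k) = k \<and> (k \<in> touched v \<longrightarrow> v \<rightarrow>\<^bsub>G\<^esub> f k)"
    by metis
  have "touched v \<subseteq> {k \<in> K. v \<rightarrow>\<^bsub>G\<^esub> (if k \<in> K then f k else k)}"
    using f touched_K by auto
  then have "card (touched v) \<le> card {k \<in> K. v \<rightarrow>\<^bsub>G\<^esub> (if k \<in> K then f k else k)}"
    using K_finite by (intro card_mono) auto
  also have "\<dots> < p"
    using f by (intro few_nbrs_transversal[OF v]) auto
  finally show ?thesis .
qed

text \<open>Together \<open>v\<close> and \<open>w\<close> touch at most \<open>2 * (p - 1)\<close>
  parts, leaving two vertices \<open>a\<close> and \<open>b\<close> of \<open>K\<close> non-adjacent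
  to both. A neighbour \<open>x\<close> of \<open>v\<close> in \<open>M\<close> would complete a
  triangle with \<open>a\<close> and \<open>b\<close> to which the edge \<open>v w\<close> is
  attached.\<close>

lemma no_nbr_in_M:
  assumes v: "v \<in> verts G - M" and w: "w \<in> verts G - M" and vw: "v \<rightarrow>\<^bsub>G\<^esub> w" and x: "x \<in> M"
  shows "\<not> v \<rightarrow>\<^bsub>G\<^esub> x"
proof
  assume vx: "v \<rightarrow>\<^bsub>G\<^esub> x"
  let ?T = "touched v \<union> touched w"
  have "card ?T \<le> card (touched v) + card (touched w)"
    by (rule card_Un_le)
  also have "\<dots> \<le> clique_number G - 2"
    using card_touched[OF v] card_touched[OF w] ge_2p by linarith
  finally have "card ?T \<le> clique_number G - 2" .
  moreover have "card (K - ?T) = card K - card ?T"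
    using K_finite touched_K by (intro card_Diff_subset) (auto intro: finite_subset)
  ultimately have "2 \<le> card (K - ?T)"
    using K(2) ge_p2 by linarith
  then obtain P where "P \<subseteq> K - ?T" "card P = 2"
    by (meson obtain_subset_with_card_n)
  then obtain a b where ab: "a \<in> K" "b \<in> K" "a \<notin> ?T" "b \<notin> ?T" "a \<noteq> b"
    by (auto simp: card_2_iff)
  have touchedI: "k \<in> touched z" if "k \<in> K" "z \<rightarrow>\<^bsub>G\<^esub> k" for z k
    unfolding touched_def using K_in_M[OF that(1)] that(2) by (intro image_eqI[of _ _ k]) auto
  have un: "\<not> a \<rightarrow>\<^bsub>G\<^esub> z" "\<not> b \<rightarrow>\<^bsub>G\<^esub> z" if "z \<in> {v, w}" for z
    using ab touchedI that adj_sym by blast+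
  \<comment> \<open>The part of \<open>x\<close> is touched, hence differs from the parts of
    \<open>a\<close> and \<open>b\<close>, and \<open>x\<close> sees both.\<close>
  have "part x \<in> touched v"
    using vx x by (auto simp: touched_def)
  then have adj: "x \<rightarrow>\<^bsub>G\<^esub> a" "x \<rightarrow>\<^bsub>G\<^esub> b" "a \<rightarrow>\<^bsub>G\<^esub> b"
    using ab adj_K[OF x] K_adj by auto
  show False
  \<comment> \<open>If \<open>x\<close> also sees \<open>w\<close>, two triangles share only
    \<open>x\<close>, a butterfly; otherwise the path \<open>x v w\<close> is the handle of a
    hammer.\<close>
  proof (cases "w \<rightarrow>\<^bsub>G\<^esub> x")
    case True
    have "x \<rightarrow>\<^bsub>G\<^esub> v" "x \<rightarrow>\<^bsub>G\<^esub> w"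
      using True vx adj_sym by blast+
    with adj vw un show False
      by (intro butterfly_free[OF free, of x a b v w]) auto
  next
    case False
    have "a \<rightarrow>\<^bsub>G\<^esub> x" "b \<rightarrow>\<^bsub>G\<^esub> x" "x \<rightarrow>\<^bsub>G\<^esub> v" "\<not> x \<rightarrow>\<^bsub>G\<^esub> w"
      using False adj vx adj_sym by blast+
    with adj vw un show False
      by (intro hammer_free[OF free, of a b x v w]) auto
  qed
qed

text \<open>By \<open>no_nbr_in_M\<close>, an edge outside \<open>M\<close> spreads along any walk
  without ever entering \<open>M\<close>, whereas connectivity provides a walk to
  \<open>K\<close>.\<close>

lemma complement_M_independent:
  assumes conn: "Digraph_Component.connected G"
    and v: "v \<in> verts G - M" and w: "w \<in> verts G - M"
  shows "\<not> v \<rightarrow>\<^bsub>G\<^esub> w"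
proof
  assume vw: "v \<rightarrow>\<^bsub>G\<^esub> w"
  have "K \<noteq> {}"
    using K(2) ge_p2 by auto
  then obtain k where k: "k \<in> K"
    by blast
  have "strongly_connected G"
    using conn by (intro symmetric_connected_imp_strongly_connected sym_arcs)
  then have "v \<rightarrow>\<^sup>*\<^bsub>G\<^esub> k"
    using v k K_verts by (auto simp: strongly_connected_def)
  \<comment> \<open>The invariant includes a neighbour outside \<open>M\<close> because
    \<open>no_nbr_in_M\<close> needs an edge there; after a step, the previous vertex serves as that
    neighbour.\<close>
  then have "k \<in> verts G - M \<and> (\<exists>z \<in> verts G - M. k \<rightarrow>\<^bsub>G\<^esub> z)"
  proof (induction rule: reachable_induct)
    case base
    then show ?case
      using v w vw by blast
  next
    case (step x y)
    then have "y \<in> verts G - M"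
      using no_nbr_in_M adj_in_verts by blast
    then show ?case
      using step adj_sym by blast
  qed
  then show False
    using K_in_M[OF k] by blast
qed

end

theorem theorem3p16:
  fixes p :: nat and G :: "('a, 'b) pre_digraph"
  assumes "Digraph.graph G"
    and "Digraph_Component.connected G"
    and "free_of {butterfly, hammer, K1_K2_join_K p} G"
    and "clique_number G \<ge> 2 * p"
    and "clique_number G \<noteq> 2"
  shows "perfect_graph G"
proof -
  interpret Digraph.graph G by fact
  show ?thesis
  proof (cases "clique_number G \<ge> 3")
    case True
    obtain K where "clique G K" "card K = clique_number G"
      by (rule maximum_clique_exists)
    \<comment> \<open>The bound \<open>p + 2 \<le> clique_number G\<close> comes from 3 for
      \<open>p \<le> 1\<close> and from \<open>2 * p\<close> for larger \<open>p\<close>.\<close>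
    then interpret maximum_clique G p K
      using assms True by unfold_locales auto
    show ?thesis
      using M_multipartite complement_M_independent[OF assms(2)]
      by (rule perfect_multipartite_independent)
  next
    case False
    \<comment> \<open>Excluding 2 leaves clique number at most 1, so the whole vertex set is
      independent and \<open>M\<close> can be taken empty.\<close>
    have no_arc: "\<not> u \<rightarrow>\<^bsub>G\<^esub> v" for u v
    proof
      assume uv: "u \<rightarrow>\<^bsub>G\<^esub> v"
      then have "clique G {u, v}"
        using adj_in_verts adj_sym by (auto simp: clique_def)
      then have "card {u, v} \<le> clique_number G"
        by (rule card_clique_le)
      moreover have "u \<noteq> v"
        using uv not_adj_refl by blast
      ultimately show False
        using False assms(5) by simp
    qed
    show ?thesis
      by (rule perfect_multipartite_independent[where M = "{}"]) (use no_arc in auto)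
  qed
qed

end
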